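(* Consider the error dynamics $$e_{t+1}=M e_t+d_t,\qquad d_t=\tau f(x_t)-\tau\hat f(x_t;\theta_t),$$ where $M$ is a stable real square matrix (spectral radius $\rho(M)<1$), $\tau>0$ is the time increment, $x_t$ is the state at time step $t$, $f$ is the uncertain part of the dynamics, and $\hat f(\cdot;\theta_t)$ is the predictor with parameter $\theta_t\in\Theta$ from the model class $\hat{\mathcal F}=\{\hat f(\cdot;\theta):\theta\in\Theta\}$. Suppose that (i) $f\in\hat{\mathcal F}$ and (ii) $\sup_{\hat f\in\hat{\mathcal F}}\|f-\hat f\|_\infty<\infty$. If the parameters $\theta_t$ are incrementally updated with an algorithm that incurs sublinear external regret and receives loss feedback $\ell_t(\theta_t)=\|d_t\|_2^2$, then the error trajectory vanishes with increasing permanence, i.e. $e_t\rightsquigarrow0$.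
   Context: Convergence with increasing permanence: a sequence $(s_t)_{t\in\mathbb N}$ in a metric space $(\mathbb S,\mathfrak d)$ converges to $s'\in\mathbb S$ with increasing permanence, written $s_t\rightsquigarrow s'$, iff for all $\epsilon>0$ and all $D,N\in\mathbb N$ there exists $n\in\mathbb N$, $n\ge N$, such that $\mathfrak d(s',s_{n+i})\le\epsilon$ for all $i\in\{1,\dots,D\}$. For $e_t$ in a finite-dimensional real vector space the metric is the Euclidean one. Setting: the error recursion is the first-order Euler discretisation (step $\tau$) of the reference error $e=x_{ref}-x$ of a plant $\ddot x=f(x)+a(x)+b(x)u$ under a feedback-linearising control law in which the unknown $f(x_t)$ is replaced by the prediction $\hat f(x_t;\theta_t)$; the recursion is taken as given. The functions $f$ and $\hat f(\cdot;\theta)$ are defined on the state space and take values in the space $\mathbb R^n$ containing $e_t$, and $\|\cdot\|_\infty$ is the supremum norm over the state space. Stage losses: $\ell_t(\theta)=\|\tau f(x_t)-\tau\hat f(x_t;\theta)\|_2^2$ for $\theta\in\Theta$, so $\ell_t(\theta_t)=\|d_t\|_2^2$. Sublinear external regret means that there is a non-negative function $\Delta$ with $\Delta(T)/T\to0$ such that $\sum_{t=1}^T\ell_t(\theta_t)-\min_{\theta\in\Theta}\sum_{t=1}^T\ell_t(\theta)\le\Delta(T)$ for all $T\in\mathbb N$, along the realised sequence of states $x_t$ (which may depend on the past parameters). *)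

theory Defs
  imports "HOL-Analysis.Analysis"
begin

definition converges_permanence :: "(nat \<Rightarrow> 'a::metric_space) \<Rightarrow> 'a \<Rightarrow> bool"
    (infix "\<leadsto>" 55) where
  "s \<leadsto> s' \<longleftrightarrow>
    (\<forall>\<epsilon>>0. \<forall>D N :: nat. \<exists>n\<ge>N. \<forall>i\<in>{1..D}. dist s' (s (n + i)) \<le> \<epsilon>)"

definition complex_spectrum :: "real^'n^'n \<Rightarrow> complex set" where
  "complex_spectrum M =
    {\<mu>. \<exists>v :: complex^'n. v \<noteq> 0 \<and> map_matrix complex_of_real M *v v = \<mu> *s v}"

text \<open>The spectrum is finite and nonempty, so this supremum is a maximum.\<close>

definition spectral_radius :: "real^'n^'n \<Rightarrow> real" where
  "spectral_radius M = (SUP \<mu>\<in>complex_spectrum M. cmod \<mu>)"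

text \<open>Extended-valued, so that finiteness is a genuine condition; the state space is the
  whole type \<open>'s\<close>.\<close>

definition sup_norm :: "('s \<Rightarrow> 'b::real_normed_vector) \<Rightarrow> ennreal" where
  "sup_norm g = (SUP \<xi>. ennreal (norm (g \<xi>)))"

definition stage_loss ::
    "real \<Rightarrow> ('s \<Rightarrow> real^'n) \<Rightarrow> ('p \<Rightarrow> 's \<Rightarrow> real^'n) \<Rightarrow> 's \<Rightarrow> 'p \<Rightarrow> real" where
  "stage_loss \<tau> f fhat \<xi> p = (norm (\<tau> *\<^sub>R f \<xi> - \<tau> *\<^sub>R fhat p \<xi>))\<^sup>2"

text \<open>\<open>l t\<close> is the loss function of round \<open>t\<close> along the realised run and \<open>\<theta> t\<close> the parameter
  played in it; rounds are numbered from 1.  The infimum over \<open>\<Theta>\<close> is the minimum whenever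
  the minimum exists.\<close>

definition sublinear_external_regret ::
    "'p set \<Rightarrow> (nat \<Rightarrow> 'p \<Rightarrow> real) \<Rightarrow> (nat \<Rightarrow> 'p) \<Rightarrow> bool" where
  "sublinear_external_regret \<Theta> l \<theta> \<longleftrightarrow>
    (\<exists>\<Delta> :: nat \<Rightarrow> real. (\<forall>T. 0 \<le> \<Delta> T) \<and> (\<lambda>T. \<Delta> T / real T) \<longlonglongrightarrow> 0 \<and>
      (\<forall>T. (\<Sum>t=1..T. l t (\<theta> t)) - (INF p\<in>\<Theta>. \<Sum>t=1..T. l t p) \<le> \<Delta> T))"

end

theory Submission
  imports Defs "HOL-Computational_Algebra.Fundamental_Theorem_Algebra"
begin

text \<open>Comparing with the parameter of \<open>f\<close> itself, the regret bounds \<open>\<Sum>\<^sub>t \<parallel>d\<^sub>t\<parallel>\<^sup>2\<close> by \<open>\<Delta> T\<close>, so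
  by Cauchy-Schwarz the averages of \<open>\<parallel>d\<^sub>t\<parallel>\<close> tend to 0. A nonzero polynomial annihilates the
  complexified \<open>M\<close>; it splits into factors \<open>M - \<mu>\<close>, and each of them can be cancelled without losing
  vanishing averages: if \<open>\<bar>\<mu>\<bar> < 1\<close>, because of a scalar contraction, and if \<open>\<bar>\<mu>\<bar> \<ge> 1\<close>,
  because \<open>\<mu>\<close> is not an eigenvalue and \<open>M - \<mu>\<close> is bounded below. Hence the averages of \<open>\<parallel>e\<^sub>t\<parallel>\<close> tend
  to 0, which fails as soon as every late window of length \<open>D\<close> contains a value above \<open>\<epsilon>\<close>.\<close>

section \<open>Sequences whose norms have vanishing averages\<close>

definition cesaro_null :: "(nat \<Rightarrow> 'a::real_normed_vector) \<Rightarrow> bool" where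
  "cesaro_null g \<longleftrightarrow> (\<lambda>T. (\<Sum>t=1..T. norm (g t)) / real T) \<longlonglongrightarrow> 0"

lemma cesaro_null_dominated:
  fixes g :: "nat \<Rightarrow> 'a::real_normed_vector" and B :: "nat \<Rightarrow> real"
  assumes B: "(\<lambda>T. B T / real T) \<longlonglongrightarrow> 0"
    and le: "\<And>T. (\<Sum>t=1..T. norm (g t)) \<le> B T"
  shows "cesaro_null g"
  unfolding cesaro_null_def
proof (rule tendsto_sandwich[OF _ _ tendsto_const B])
  show "\<forall>\<^sub>F T in sequentially. 0 \<le> (\<Sum>t=1..T. norm (g t)) / real T"
    by (intro always_eventually allI divide_nonneg_nonneg sum_nonneg) auto
  show "\<forall>\<^sub>F T in sequentially. (\<Sum>t=1..T. norm (g t)) / real T \<le> B T / real T"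
    using le by (intro always_eventually allI divide_right_mono) auto
qed

lemma cesaro_null_bound:
  fixes g :: "nat \<Rightarrow> 'a::real_normed_vector" and h :: "nat \<Rightarrow> 'b::real_normed_vector"
  assumes h: "cesaro_null h" and le: "\<And>t. t \<ge> 1 \<Longrightarrow> norm (g t) \<le> K * norm (h t)"
  shows "cesaro_null g"
proof (rule cesaro_null_dominated)
  show "(\<lambda>T. (K * (\<Sum>t=1..T. norm (h t))) / real T) \<longlonglongrightarrow> 0"
    using tendsto_mult_right_zero[OF h[unfolded cesaro_null_def], of K] by simp
  show "(\<Sum>t=1..T. norm (g t)) \<le> K * (\<Sum>t=1..T. norm (h t))" for T
    unfolding sum_distrib_left using le by (intro sum_mono) auto
qed

lemma cesaro_null_add:
  fixes g h :: "nat \<Rightarrow> 'a::real_normed_vector"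
  assumes "cesaro_null g" "cesaro_null h"
  shows "cesaro_null (\<lambda>t. g t + h t)"
proof (rule cesaro_null_dominated)
  show "(\<lambda>T. ((\<Sum>t=1..T. norm (g t)) + (\<Sum>t=1..T. norm (h t))) / real T) \<longlonglongrightarrow> 0"
    using tendsto_add_zero[OF assms[unfolded cesaro_null_def]] by (simp add: add_divide_distrib)
  show "(\<Sum>t=1..T. norm (g t + h t)) \<le> (\<Sum>t=1..T. norm (g t)) + (\<Sum>t=1..T. norm (h t))" for T
    unfolding sum.distrib[symmetric] by (intro sum_mono norm_triangle_ineq)
qed

lemma cesaro_null_linear:
  fixes L :: "'a::euclidean_space \<Rightarrow> 'b::real_normed_vector"
  assumes "linear L" "cesaro_null g"
  shows "cesaro_null (\<lambda>t. L (g t))"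
proof -
  obtain K where "\<And>x. norm (L x) \<le> K * norm x"
    using linear_bounded[OF assms(1)] by auto
  then show ?thesis
    by (rule cesaro_null_bound[OF assms(2)])
qed

text \<open>Cauchy-Schwarz against the constant 1 bounds the sum of norms by
  \<open>sqrt (real T * \<Delta> T)\<close>, and dividing by \<open>T\<close> leaves
  \<open>sqrt (\<Delta> T / real T)\<close>.\<close>

lemma cesaro_null_if_square_sum:
  fixes g :: "nat \<Rightarrow> 'a::real_normed_vector"
  assumes lim: "(\<lambda>T. \<Delta> T / real T) \<longlonglongrightarrow> 0"
    and le: "\<And>T. (\<Sum>t=1..T. (norm (g t))\<^sup>2) \<le> \<Delta> T"
  shows "cesaro_null g"
proof (rule cesaro_null_dominated)
  \<comment> \<open>For \<open>T = 0\<close> both sides are 0, by the convention for division by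
    0.\<close>
  have eq: "sqrt (\<Delta> T / real T) = sqrt (real T * \<Delta> T) / real T" for T
  proof -
    have "\<Delta> T / real T = real T * \<Delta> T / (real T)\<^sup>2"
      by (simp add: power2_eq_square)
    then show ?thesis by (simp add: real_sqrt_divide)
  qed
  show "(\<lambda>T. sqrt (real T * \<Delta> T) / real T) \<longlonglongrightarrow> 0"
    using tendsto_real_sqrt[OF lim] by (simp add: eq)
  fix T
  have "(\<Sum>t=1..T. norm (g t))\<^sup>2 \<le> (\<Sum>t=1..T. (norm (g t))\<^sup>2) * (\<Sum>t=1..T. 1\<^sup>2)"
    using Cauchy_Schwarz_ineq_sum[of "\<lambda>t. norm (g t)" "\<lambda>_. 1" "{1..T}"] by simp
  also have "\<dots> \<le> real T * \<Delta> T"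
    using mult_left_mono[OF le[of T], of "real T"] by (simp add: mult.commute)
  finally show "(\<Sum>t=1..T. norm (g t)) \<le> sqrt (real T * \<Delta> T)"
    by (rule real_le_rsqrt)
qed

text \<open>Summing the step inequality bounds the sum up to \<open>Suc T\<close> by the first term,
  \<open>r\<close> times the sum up to \<open>T\<close>, and the sum of the forcing. The sums are
  monotone in \<open>T\<close>, so the \<open>r\<close>-term can be absorbed on the left.\<close>

lemma cesaro_null_contraction:
  fixes y u :: "nat \<Rightarrow> 'a::real_normed_vector" and r :: real
  assumes r: "r < 1" and u: "cesaro_null u"
    and step: "\<And>t. t \<ge> 1 \<Longrightarrow> norm (y (t + 1)) \<le> r * norm (y t) + norm (u t)"
  shows "cesaro_null y"
proof (rule cesaro_null_dominated)
  let ?Y = "\<lambda>T. \<Sum>t=1..T. norm (y t)" and ?U = "\<lambda>T. \<Sum>t=1..T. norm (u t)"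
  have "(\<lambda>T. (norm (y 1) / real T + ?U T / real T) / (1 - r)) \<longlonglongrightarrow> (0 + 0) / (1 - r)"
    using r u by (intro tendsto_intros lim_const_over_n) (auto simp: cesaro_null_def)
  then show "(\<lambda>T. (norm (y 1) + ?U T) / (1 - r) / real T) \<longlonglongrightarrow> 0"
    by (simp add: add_divide_distrib mult.commute)
  fix T
  have "?Y (Suc T) \<le> norm (y 1) + r * ?Y T + ?U T"
  proof (induction T)
    case (Suc T)
    then show ?case using step[of "Suc T"] by (simp add: algebra_simps)
  qed simp
  moreover have "?Y T \<le> ?Y (Suc T)" by simp
  ultimately have "?Y T - r * ?Y T \<le> norm (y 1) + ?U T" by linarith
  then have "(1 - r) * ?Y T \<le> norm (y 1) + ?U T"
    by (simp add: left_diff_distrib)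
  then show "?Y T \<le> (norm (y 1) + ?U T) / (1 - r)"
    using r by (simp add: pos_le_divide_eq mult.commute)
qed

section \<open>From vanishing averages to increasing permanence\<close>

lemma cesaro_null_converges_permanence:
  fixes e :: "nat \<Rightarrow> 'a::real_normed_vector"
  assumes null: "cesaro_null e"
  shows "e \<leadsto> 0"
  unfolding converges_permanence_def
proof (intro allI impI, rule ccontr)
  fix \<epsilon> :: real and D N :: nat
  assume eps: "\<epsilon> > 0" and no: "\<not> (\<exists>n\<ge>N. \<forall>i\<in>{1..D}. dist 0 (e (n + i)) \<le> \<epsilon>)"
  let ?S = "\<lambda>T. \<Sum>t=1..T. norm (e t)"
  have large: "\<exists>i\<in>{1..D}. \<epsilon> < norm (e (n + i))" if "n \<ge> N" for n
    using no that by (auto simp: not_le[symmetric])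
  have D: "D \<ge> 1"
    using large[of N] by auto
  \<comment> \<open>Each of the \<open>k\<close> consecutive blocks of length \<open>D\<close> after
    \<open>N\<close> contributes more than \<epsilon>, so the sums grow at a rate of at least
    \<epsilon> per \<open>D\<close> steps.\<close>
  have sum_ge: "real k * \<epsilon> \<le> ?S (N + k * D)" for k
  proof (induction k)
    case 0
    then show ?case by (simp add: sum_nonneg)
  next
    case (Suc k)
    obtain i where i: "i \<in> {1..D}" "\<epsilon> < norm (e (N + k * D + i))"
      using large[of "N + k * D"] by auto
    have "\<epsilon> \<le> (\<Sum>t\<in>{N + k * D + i}. norm (e t))"
      using i by simp
    also have "\<dots> \<le> (\<Sum>t\<in>{N + k * D + 1..N + k * D + D}. norm (e t))"
      using i by (intro sum_mono2) auto
    also have "?S (N + k * D) + \<dots> = ?S (N + Suc k * D)"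
      using sum.ub_add_nat[of 1 "N + k * D" "\<lambda>t. norm (e t)" D] by (simp add: ac_simps)
    finally show ?case
      using Suc by (simp add: algebra_simps)
  qed
  \<comment> \<open>Half of that growth rate.\<close>
  define \<delta> where "\<delta> = \<epsilon> / (2 * real D)"
  have "\<delta> > 0" using eps D by (simp add: \<delta>_def)
  then have "\<forall>\<^sub>F T in sequentially. ?S T / real T < \<delta>"
    using null order_tendstoD(2) unfolding cesaro_null_def by blast
  then obtain T0 where T0: "\<And>T. T \<ge> T0 \<Longrightarrow> ?S T / real T < \<delta>"
    by (auto simp: eventually_sequentially)
  \<comment> \<open>With \<open>k \<ge> T0\<close> the last block ends beyond \<open>T0\<close>;
    with \<open>k \<ge> N\<close> the offset \<delta> * \<open>N\<close> costs at most the other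
    half of \<open>k\<close> * \<epsilon>; the added 1 makes the end index positive.\<close>
  define k where "k = N + T0 + 1"
  have "k \<le> k * D" using D by simp
  then have "N + k * D \<ge> T0" "N + k * D > 0" unfolding k_def by linarith+
  then have T: "N + k * D \<ge> T0" "real (N + k * D) > 0" by (simp_all only: of_nat_0_less_iff)
  have "real k * \<epsilon> < \<delta> * real (N + k * D)"
    using sum_ge[of k] T0[OF T(1)] T(2) by (simp add: pos_divide_less_eq del: of_nat_add)
  also have "\<dots> = \<delta> * real N + real k * \<epsilon> / 2"
    using D by (simp add: \<delta>_def field_simps)
  also have "\<delta> * real N \<le> \<epsilon> / 2 * real k"
  proof (rule mult_mono)
    show "\<delta> \<le> \<epsilon> / 2" using eps D by (simp add: \<delta>_def field_simps)
  qed (use eps in \<open>auto simp: k_def\<close>)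
  finally show False by simp
qed

section \<open>Polynomials in a complex matrix\<close>

text \<open>This is \<open>p(A) v\<close> by Horner's scheme, which needs no matrix powers and lets
  the proofs below go by induction on \<open>pCons\<close>.\<close>

definition poly_act :: "complex^'n^'n \<Rightarrow> complex poly \<Rightarrow> complex^'n \<Rightarrow> complex^'n" where
  "poly_act A p v = fold_coeffs (\<lambda>a w. a *s v + A *v w) p 0"

lemma poly_act_0 [simp]: "poly_act A 0 v = 0"
  by (simp add: poly_act_def)

lemma poly_act_pCons [simp]: "poly_act A (pCons a p) v = a *s v + A *v poly_act A p v"
  by (cases "p = 0 \<and> a = 0") (auto simp: poly_act_def)

lemma poly_act_add: "poly_act A (p + q) v = poly_act A p v + poly_act A q v"
  by (induction p q rule: poly_induct2)
    (simp_all add: vec.scale_left_distrib matrix_vector_right_distrib)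

lemma poly_act_smult: "poly_act A (smult c p) v = c *s poly_act A p v"
  by (induction p) (simp_all add: vec.scale_right_distrib vector_scalar_commute)

lemma poly_act_sum: "poly_act A (\<Sum>i\<in>I. p i) v = (\<Sum>i\<in>I. poly_act A (p i) v)"
  by (induction I rule: infinite_finite_induct) (simp_all add: poly_act_add)

lemma poly_act_linear_factor:
  "poly_act A ([:- \<mu>, 1:] * q) v = A *v poly_act A q v - \<mu> *s poly_act A q v"
proof -
  have "[:- \<mu>, 1:] * q = smult (- \<mu>) q + pCons 0 q" by simp
  then show ?thesis by (simp only: poly_act_add poly_act_smult poly_act_pCons) simp
qed

lemma linear_scalar_mult_vec: "linear (\<lambda>v :: complex^'n. c *s v)"
  by (rule linearI) (simp_all add: vec_eq_iff algebra_simps)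

lemma linear_complex_matrix: "linear (\<lambda>v :: complex^'n. (A :: complex^'n^'m) *v v)"
  by (rule linearI)
    (simp_all add: vec_eq_iff matrix_vector_mult_def algebra_simps sum.distrib scaleR_sum_right)

lemma linear_poly_act: "linear (poly_act A p)"
proof (induction p)
  case 0
  show ?case by (rule linearI) auto
next
  case (pCons a p)
  have "linear (\<lambda>v. A *v poly_act A p v)"
    using linear_compose[OF pCons.IH linear_complex_matrix[of A]] by (simp add: o_def)
  from linear_compose_add[OF linear_scalar_mult_vec this] show ?case by simp
qed

lemma poly_act_commute: "poly_act A p (A *v v) = A *v poly_act A p v"
  by (induction p) (simp_all add: matrix_vector_right_distrib vector_scalar_commute)

text \<open>One vector more than the dimension forces dependence. Since \<open>dependent\<close>
  speaks of sets, a repeated vector is treated apart, with coefficients 1 and -1.\<close>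

lemma linear_dependence_sequence:
  fixes m :: "nat \<Rightarrow> 'a::euclidean_space"
  obtains c :: "nat \<Rightarrow> real" and k :: nat
  where "k \<le> DIM('a)" "c k \<noteq> 0" "(\<Sum>i\<le>DIM('a). c i *\<^sub>R m i) = 0"
proof (cases "inj_on m {..DIM('a)}")
  case True
  have "dependent (m ` {..DIM('a)})"
    using True by (intro dependent_biggerset) (auto simp: card_image)
  then obtain u where u: "\<exists>v\<in>m ` {..DIM('a)}. u v \<noteq> 0" "(\<Sum>v\<in>m ` {..DIM('a)}. u v *\<^sub>R v) = 0"
    using dependent_finite[of "m ` {..DIM('a)}"] by auto
  then obtain k where "k \<le> DIM('a)" "u (m k) \<noteq> 0" by auto
  moreover have "(\<Sum>i\<le>DIM('a). u (m i) *\<^sub>R m i) = 0"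
    using u(2) True by (simp add: sum.reindex)
  ultimately show ?thesis
    using that[of k "\<lambda>i. u (m i)"] by simp
next
  case False
  then obtain i j where ij: "i \<le> DIM('a)" "j \<le> DIM('a)" "i \<noteq> j" "m i = m j"
    by (auto simp: inj_on_def)
  let ?c = "\<lambda>l. (if l = i then 1 else 0) - (if l = j then 1 else 0) :: real"
  have "(\<Sum>l\<le>DIM('a). ?c l *\<^sub>R m l) = m i - m j"
    using ij(1,2) by (simp add: scaleR_diff_left sum_subtractf if_distrib[of "\<lambda>a. a *\<^sub>R _"] cong: if_cong)
  then show ?thesis
    using that[of i ?c] ij by simp
qed

text \<open>The powers of \<open>A\<close> live in a space of finite real dimension, so finitely
  many of them are dependent; the real coefficients of the relation give \<open>p\<close>. No bound
  on the degree is needed, so this replaces Cayley-Hamilton.\<close>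

lemma annihilating_poly:
  fixes A :: "complex^'n^'n"
  obtains p where "p \<noteq> 0" "\<And>v. poly_act A p v = 0"
proof -
  let ?m = "\<lambda>i. ((\<lambda>B. A ** B) ^^ i) (mat 1)" and ?N = "DIM(complex^'n^'n)"
  obtain c k where k: "k \<le> ?N" "c k \<noteq> 0" and c: "(\<Sum>i\<le>?N. c i *\<^sub>R ?m i) = 0"
    by (rule linear_dependence_sequence)
  define p where "p = (\<Sum>i\<le>?N. monom (complex_of_real (c i)) i)"
  have "coeff p k = c k"
    using k(1) by (simp add: p_def coeff_sum)
  then have "p \<noteq> 0" using k(2) by auto
  moreover have "poly_act A p v = 0" for v
  proof -
    have pow: "poly_act A (monom a i) v = a *s (?m i *v v)" for a i
      by (induction i)
        (simp_all add: monom_0 monom_Suc vector_scalar_commute flip: matrix_vector_mul_assoc)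
    have lin: "linear (\<lambda>B :: complex^'n^'n. B *v v)"
      by (rule linearI)
        (simp_all add: vec_eq_iff matrix_vector_mult_def algebra_simps sum.distrib scaleR_sum_right)
    have scale: "complex_of_real a *s w = a *\<^sub>R w" for a and w :: "complex^'n"
      by (simp add: vec_eq_iff flip: scaleR_conv_of_real)
    have "poly_act A p v = (\<Sum>i\<le>?N. c i *\<^sub>R (?m i *v v))"
      by (simp add: p_def poly_act_sum pow scale)
    also have "\<dots> = (\<Sum>i\<le>?N. c i *\<^sub>R ?m i) *v v"
      by (simp add: linear_sum[OF lin] linear_cmul[OF lin])
    also have "\<dots> = 0" unfolding c by simp
    finally show ?thesis .
  qed
  ultimately show ?thesis using that by blast
qed

section \<open>Cancelling linear factors along the recursion\<close>

lemma norm_scalar_mult_vec: "norm (c *s v) = cmod c * norm (v :: complex^'n)"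
  by (simp add: norm_vec_def L2_set_right_distrib norm_mult)

lemma cesaro_null_cancel_factor:
  fixes A :: "complex^'n^'n" and y u :: "nat \<Rightarrow> complex^'n"
  assumes eig: "\<And>\<mu> v. v \<noteq> 0 \<Longrightarrow> A *v v = \<mu> *s v \<Longrightarrow> cmod \<mu> < 1"
    and step: "\<And>t. t \<ge> 1 \<Longrightarrow> y (t + 1) = A *v y t + u t"
    and u: "cesaro_null u"
    and factor: "cesaro_null (\<lambda>t. A *v y t - \<mu> *s y t)"
  shows "cesaro_null y"
proof (cases "cmod \<mu> < 1")
  case True
  show ?thesis
  proof (rule cesaro_null_contraction[OF True cesaro_null_add[OF factor u]])
    fix t :: nat assume "t \<ge> 1"
    \<comment> \<open>The matrix recursion becomes a scalar one, with the factor term moved into the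
      forcing.\<close>
    then have "y (t + 1) = \<mu> *s y t + (A *v y t - \<mu> *s y t + u t)"
      using step by simp
    then show "norm (y (t + 1)) \<le> cmod \<mu> * norm (y t) + norm (A *v y t - \<mu> *s y t + u t)"
      by (metis norm_scalar_mult_vec norm_triangle_ineq)
  qed
next
  case False
  let ?L = "\<lambda>v. A *v v - \<mu> *s v"
  have lin: "linear ?L"
    by (intro linear_compose_sub linear_complex_matrix linear_scalar_mult_vec)
  \<comment> \<open>A nonzero kernel vector would be an eigenvector for \<mu>, against
    \<open>eig\<close>.\<close>
  have "inj ?L"
    unfolding linear_injective_0[OF lin] using eig False by auto
  with lin obtain B where B: "B > 0" "\<And>v. B * norm v \<le> norm (?L v)"
    by (rule linear_inj_bounded_below_pos) blast
  show ?thesis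
  proof (rule cesaro_null_bound[OF factor])
    show "norm (y t) \<le> inverse B * norm (?L (y t))" for t
      using B by (simp add: field_simps)
  qed
qed

text \<open>Induction on the degree, splitting off a root of \<open>p\<close>. As
  \<open>q(A)\<close> commutes with \<open>A\<close>, the sequence \<open>q(A) e\<close> obeys the
  same recursion with forcing \<open>q(A) d\<close>, so the factor can be cancelled, leaving
  \<open>q\<close>.\<close>

lemma cesaro_null_if_poly_act:
  fixes A :: "complex^'n^'n" and e d :: "nat \<Rightarrow> complex^'n"
  assumes eig: "\<And>\<mu> v. v \<noteq> 0 \<Longrightarrow> A *v v = \<mu> *s v \<Longrightarrow> cmod \<mu> < 1"
    and step: "\<And>t. t \<ge> 1 \<Longrightarrow> e (t + 1) = A *v e t + d t"
    and d: "cesaro_null d"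
    and "p \<noteq> 0" and "cesaro_null (\<lambda>t. poly_act A p (e t))"
  shows "cesaro_null e"
  using assms(4,5)
proof (induction "degree p" arbitrary: p)
  case 0
  then obtain c where c: "p = [:c:]" "c \<noteq> 0"
    by (metis degree_eq_zeroE pCons_0_0)
  show ?case
    by (rule cesaro_null_bound[OF "0.prems"(2), of e "inverse (cmod c)"])
      (use c in \<open>auto simp: norm_scalar_mult_vec field_simps\<close>)
next
  case (Suc k)
  have "\<not> constant (poly p)"
    using Suc.hyps(2) by (simp add: constant_degree)
  then obtain \<mu> where "poly p \<mu> = 0"
    using fundamental_theorem_of_algebra by blast
  then obtain q where q: "p = [:- \<mu>, 1:] * q"
    by (auto simp: poly_eq_0_iff_dvd elim: dvdE)
  have q0: "q \<noteq> 0" using Suc.prems(1) q by auto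
  have "degree p = Suc (degree q)"
    using q0 unfolding q by (subst degree_mult_eq) auto
  then have deg: "k = degree q" using Suc.hyps(2) by simp
  show ?case
  proof (rule Suc.hyps(1)[OF deg q0], rule cesaro_null_cancel_factor[OF eig])
    show "poly_act A q (e (t + 1)) = A *v poly_act A q (e t) + poly_act A q (d t)" if "t \<ge> 1" for t
      using step[OF that] by (simp add: linear_add[OF linear_poly_act] poly_act_commute)
    show "cesaro_null (\<lambda>t. poly_act A q (d t))"
      by (rule cesaro_null_linear[OF linear_poly_act d])
    show "cesaro_null (\<lambda>t. A *v poly_act A q (e t) - \<mu> *s poly_act A q (e t))"
      using Suc.prems(2) unfolding q poly_act_linear_factor .
  qed
qed

section \<open>Spectral radius and passage to complex vectors\<close>

lemma cmod_eigenvalue_le_spectral_radius: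
  fixes M :: "real^'n^'n"
  assumes "v \<noteq> 0" "map_matrix complex_of_real M *v v = \<mu> *s v"
  shows "cmod \<mu> \<le> spectral_radius M"
  unfolding spectral_radius_def
proof (rule cSUP_upper)
  show "\<mu> \<in> complex_spectrum M"
    using assms by (auto simp: complex_spectrum_def)
  \<comment> \<open>The real supremum is an upper bound only for a bounded set; a bound for the
    linear map bounds every eigenvalue.\<close>
  obtain K where K: "\<And>v. norm (map_matrix complex_of_real M *v v) \<le> K * norm v"
    using linear_bounded[OF linear_complex_matrix] by blast
  show "bdd_above (cmod ` complex_spectrum M)"
  proof (rule bdd_aboveI2)
    fix \<nu> assume "\<nu> \<in> complex_spectrum M"
    then obtain w where "w \<noteq> 0" "map_matrix complex_of_real M *v w = \<nu> *s w"
      by (auto simp: complex_spectrum_def)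
    then show "cmod \<nu> \<le> K"
      using K[of w] by (simp add: norm_scalar_mult_vec)
  qed
qed

text \<open>A real matrix may have non-real eigenvalues, so the recursion is carried over to complex
  vectors by this isometric embedding.\<close>

definition complexify :: "real^'n \<Rightarrow> complex^'n" where
  "complexify v = (\<chi> i. complex_of_real (v $ i))"

lemma norm_complexify [simp]: "norm (complexify v) = norm v"
  by (simp add: complexify_def norm_vec_def)

lemma complexify_add: "complexify (v + w) = complexify v + complexify w"
  by (simp add: complexify_def vec_eq_iff)

lemma complexify_matrix:
  "complexify (M *v v) = map_matrix complex_of_real M *v complexify v"
  by (simp add: complexify_def vec_eq_iff matrix_vector_mult_def map_matrix_def)

lemma cesaro_null_stable_recursion:
  fixes M :: "real^'n^'n" and e d :: "nat \<Rightarrow> real^'n"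
  assumes stable: "spectral_radius M < 1"
    and step: "\<And>t. t \<ge> 1 \<Longrightarrow> e (t + 1) = M *v e t + d t"
    and d: "cesaro_null d"
  shows "cesaro_null e"
proof -
  let ?A = "map_matrix complex_of_real M"
  obtain p where p: "p \<noteq> 0" "\<And>v. poly_act ?A p v = 0"
    by (rule annihilating_poly[of ?A]) blast
  have "cesaro_null (\<lambda>t. complexify (e t))"
  proof (rule cesaro_null_if_poly_act[of ?A _ "\<lambda>t. complexify (d t)" p])
    show "cmod \<mu> < 1" if "v \<noteq> 0" "?A *v v = \<mu> *s v" for \<mu> v
      using cmod_eigenvalue_le_spectral_radius[OF that] stable by simp
    show "complexify (e (t + 1)) = ?A *v complexify (e t) + complexify (d t)" if "t \<ge> 1" for t
      using step[OF that] by (simp add: complexify_add complexify_matrix)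
    show "cesaro_null (\<lambda>t. complexify (d t))"
      using d by (simp add: cesaro_null_def)
    show "cesaro_null (\<lambda>t. poly_act ?A p (complexify (e t)))"
      by (simp add: p(2) cesaro_null_def)
  qed (rule p(1))
  then show ?thesis by (simp add: cesaro_null_def)
qed

section \<open>Regret bound and conclusion\<close>

theorem theorem5:
  fixes M :: "real^'n^'n"
    and \<tau> :: real
    and f :: "'s \<Rightarrow> real^'n"
    and fhat :: "'p \<Rightarrow> 's \<Rightarrow> real^'n"
    and \<Theta> :: "'p set"
    and x :: "nat \<Rightarrow> 's"
    and \<theta> :: "nat \<Rightarrow> 'p"
    and e d :: "nat \<Rightarrow> real^'n"
  assumes stable: "spectral_radius M < 1"
    and tau_pos: "\<tau> > 0"
    and params: "\<And>t. t \<ge> 1 \<Longrightarrow> \<theta> t \<in> \<Theta>"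
    and error_dynamics: "\<And>t. t \<ge> 1 \<Longrightarrow> e (t + 1) = M *v e t + d t"
    and disturbance: "\<And>t. t \<ge> 1 \<Longrightarrow> d t = \<tau> *\<^sub>R f (x t) - \<tau> *\<^sub>R fhat (\<theta> t) (x t)"
    and realisable: "f \<in> fhat ` \<Theta>"
    and bounded_class: "(SUP g\<in>fhat ` \<Theta>. sup_norm (\<lambda>\<xi>. f \<xi> - g \<xi>)) < \<infinity>"
    and regret: "sublinear_external_regret \<Theta> (\<lambda>t. stage_loss \<tau> f fhat (x t)) \<theta>"
  shows "e \<leadsto> 0"
proof -
  let ?l = "\<lambda>t. stage_loss \<tau> f fhat (x t)"
  obtain \<Delta> where \<Delta>: "(\<lambda>T. \<Delta> T / real T) \<longlonglongrightarrow> 0"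
    "\<And>T. (\<Sum>t=1..T. ?l t (\<theta> t)) - (INF p\<in>\<Theta>. \<Sum>t=1..T. ?l t p) \<le> \<Delta> T"
    using regret unfolding sublinear_external_regret_def by blast
  obtain q where q: "q \<in> \<Theta>" "fhat q = f"
    using realisable by auto
  have "cesaro_null d"
  proof (rule cesaro_null_if_square_sum[OF \<Delta>(1)])
    fix T
    \<comment> \<open>The comparator \<open>q\<close> represents \<open>f\<close> and has zero loss
      in every round. Losses are nonnegative, so the infimum is over a set bounded below.\<close>
    have "(INF p\<in>\<Theta>. \<Sum>t=1..T. ?l t p) \<le> (\<Sum>t=1..T. ?l t q)"
      by (rule cINF_lower[OF _ q(1)], rule bdd_belowI2[where m = 0])
        (simp add: stage_loss_def sum_nonneg)
    also have "\<dots> = 0"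
      by (simp add: stage_loss_def q(2))
    finally have "(\<Sum>t=1..T. ?l t (\<theta> t)) \<le> \<Delta> T"
      using \<Delta>(2)[of T] by simp
    moreover have "(\<Sum>t=1..T. (norm (d t))\<^sup>2) = (\<Sum>t=1..T. ?l t (\<theta> t))"
      by (rule sum.cong) (auto simp: stage_loss_def disturbance)
    ultimately show "(\<Sum>t=1..T. (norm (d t))\<^sup>2) \<le> \<Delta> T" by simp
  qed
  with stable error_dynamics have "cesaro_null e"
    by (rule cesaro_null_stable_recursion)
  then show ?thesis
    by (rule cesaro_null_converges_permanence)
qed

end
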